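(* If a function $f : \mathbb{R}^d \to \mathbb{R}^p$ is gauge-measurable, then there exists a sequence of gauge-measurable step functions $(f_n)_{n \in \mathbb{N}}$ from $\mathbb{R}^d$ to $\mathbb{R}^p$ which converges pointwise to $f$ in $\mathbb{R}^d$ and satisfies $|f_n| \leq |f|$ in $\mathbb{R}^d$ for every $n \in \mathbb{N}$.
   Context: A gauge $\gamma$ on $\mathbb{R}^d$ is a function mapping each point $x \in \mathbb{R}^d$ to an open set $\gamma(x) \subset \mathbb{R}^d$ such that $x \in \gamma(x)$. A rectangle in $\mathbb{R}^d$ is a set of the form $R = [a_1,b_1) \times \cdots \times [a_d,b_d)$ with real numbers $a_1<b_1, \ldots, a_d<b_d$; its volume is $\operatorname{vol}(R) = (b_1-a_1)\cdots(b_d-a_d)$. A finite family of rectangles is disjoint if the rectangles are pairwise disjoint. Gauge measurability: a function $f : \mathbb{R}^d \to \mathbb{R}^p$ is gauge-measurable whenever, for every $\epsilon>0$ and every $\eta>0$, there exists a gauge $\gamma$ on $\mathbb{R}^d$ such that, for every finite family of disjoint rectangles $(R_i)_{i\in\{1,\ldots,k\}}$ in $\mathbb{R}^d$ and finite families of points $(c_i)_{i\in\{1,\ldots,k\}}$ and $(c'_i)_{i\in\{1,\ldots,k\}}$ in $\mathbb{R}^d$ satisfying $|f(c_i)-f(c'_i)| \geq \eta$ and $R_i \subset \gamma(c_i)\cap\gamma(c'_i)$ for every $i\in\{1,\ldots,k\}$, one has $\sum_{i=1}^k \operatorname{vol}(R_i) \leq \epsilon$. A function $g : \mathbb{R}^d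 \to \mathbb{R}^p$ is a step function if its image $g(\mathbb{R}^d)$ is a finite set. *)

theory Defs
  imports "HOL-Analysis.Analysis"
begin

text \<open>The library interval \<open>{a..<b}\<close> is not used here: on vectors, \<open>x < b\<close> means
  \<open>x \<le> b \<and> x \<noteq> b\<close>, which is weaker than strict inequality in every coordinate.\<close>

definition rectangle :: "real ^ 'd \<Rightarrow> real ^ 'd \<Rightarrow> (real ^ 'd) set" where
  "rectangle a b = {x. \<forall>j. a $ j \<le> x $ j \<and> x $ j < b $ j}"

text \<open>A rectangle is given by its corners \<open>a\<close> and \<open>b\<close>, with \<open>a $ j < b $ j\<close> for every \<open>j\<close>. It
  determines them, so its volume can be taken as a function of the corners.\<close>

definition rectangle_vol :: "real ^ 'd \<Rightarrow> real ^ 'd \<Rightarrow> real" where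
  "rectangle_vol a b = (\<Prod>j\<in>UNIV. b $ j - a $ j)"

definition gauge_measurable :: "(real ^ 'd \<Rightarrow> real ^ 'p) \<Rightarrow> bool" where
  "gauge_measurable f \<longleftrightarrow>
    (\<forall>\<epsilon>>0. \<forall>\<eta>>0. \<exists>\<gamma>. gauge \<gamma> \<and>
      (\<forall>(k::nat) (a :: nat \<Rightarrow> real ^ 'd) (b :: nat \<Rightarrow> real ^ 'd)
          (c :: nat \<Rightarrow> real ^ 'd) (c' :: nat \<Rightarrow> real ^ 'd).
        (\<forall>i\<in>{1..k}. \<forall>j. a i $ j < b i $ j) \<longrightarrow>
        disjoint_family_on (\<lambda>i. rectangle (a i) (b i)) {1..k} \<longrightarrow>
        (\<forall>i\<in>{1..k}. norm (f (c i) - f (c' i)) \<ge> \<eta> \<and>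
                     rectangle (a i) (b i) \<subseteq> \<gamma> (c i) \<inter> \<gamma> (c' i)) \<longrightarrow>
        (\<Sum>i\<in>{1..k}. rectangle_vol (a i) (b i)) \<le> \<epsilon>))"

definition step_function :: "(real ^ 'd \<Rightarrow> real ^ 'p) \<Rightarrow> bool" where
  "step_function g \<longleftrightarrow> finite (range g)"

end

theory Submission
  imports Defs
begin

text \<open>The idea is to pass through Lebesgue measurability. If \<open>S\<close> and \<open>T\<close> are at distance at
  least \<open>\<eta>\<close>, the gauges at points of \<open>f -` S\<close> and of \<open>f -` T\<close> give open sets \<open>U\<close> and
  \<open>V\<close>; filling a bounded part of \<open>U \<inter> V\<close> by rectangles shows that it is small. So
  \<open>f -` S\<close> is contained in a Borel set that meets \<open>f -` T\<close> in a null set, and hence \<open>f\<close> is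
  Lebesgue measurable. Conversely, outer regularity of the finitely many level sets of a Lebesgue
  measurable step function yields the gauges it needs.\<close>

section \<open>Half-open rectangles, boxes and volumes\<close>

lemma rectangle_subset_cbox: "rectangle a b \<subseteq> cbox a b"
  by (auto simp: rectangle_def mem_box_cart less_imp_le)

lemma box_subset_rectangle: "box a b \<subseteq> rectangle a b"
  by (auto simp: rectangle_def mem_box_cart less_imp_le)

lemma rectangle_vol_eq_measure_cbox:
  assumes "\<And>j. a $ j < b $ j"
  shows "rectangle_vol a b = measure lebesgue (cbox a b)"
proof -
  have "cbox a b \<noteq> {}"
    using assms by (simp add: interval_ne_empty_cart less_imp_le)
  then show ?thesis
    by (simp add: rectangle_vol_def content_cbox_cart)
qed

lemma lmeasurable_rectangle: "rectangle a b \<in> lmeasurable"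
proof -
  have "rectangle a b = (\<Inter>j. {x. a $ j \<le> x $ j} \<inter> {x. x $ j < b $ j})"
    by (auto simp: rectangle_def)
  also have "\<dots> \<in> sets borel"
    by (intro sets.countable_INT'' sets.Int borel_closed borel_open closed_halfspace_component_ge_cart
        open_halfspace_component_lt_cart) auto
  finally have "rectangle a b \<in> sets lebesgue"
    by simp
  then show ?thesis
    by (metis fmeasurableI2 lmeasurable_cbox rectangle_subset_cbox)
qed

lemma rectangle_vol_le_measure:
  assumes "\<And>j. a $ j < b $ j"
  shows "rectangle_vol a b \<le> measure lebesgue (rectangle a b)"
proof -
  have "rectangle_vol a b = measure lebesgue (box a b)"
    using rectangle_vol_eq_measure_cbox[OF assms]
    by (simp add: measure_lborel_box_eq measure_lborel_cbox_eq)
  also have "\<dots> \<le> measure lebesgue (rectangle a b)"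
    by (intro measure_mono_fmeasurable box_subset_rectangle lmeasurable_rectangle) auto
  finally show ?thesis .
qed

text \<open>Disjoint open boxes have a coordinate in which one of them is degenerate or one ends no
  later than the other begins; the half-open sides are disjoint there too. This turns the disjoint
  interiors of a covering by closed boxes into disjoint rectangles.\<close>

lemma disjoint_rectangle:
  assumes "box a b \<inter> box c d = {}"
  shows "rectangle a b \<inter> rectangle c d = {}"
proof -
  obtain j where "b$j \<le> a$j \<or> d$j \<le> c$j \<or> b$j \<le> c$j \<or> d$j \<le> a$j"
    using assms by (auto simp: disjoint_interval_cart)
  then show ?thesis
    by (auto simp: rectangle_def set_eq_iff) (meson dual_order.strict_trans1 not_less)+
qed

section \<open>From gauge measurability to Lebesgue measurability\<close>

text \<open>Half-open versions of the boxes supplied by \<open>covering_lemma\<close> serve as the family of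
  rectangles.\<close>

lemma bounded_part_measure_le:
  fixes g :: "real ^ 'd \<Rightarrow> (real ^ 'd) set"
  assumes g: "\<And>x. x \<in> W \<Longrightarrow> x \<in> g x" "\<And>x. x \<in> W \<Longrightarrow> open (g x)"
    and bound: "\<And>(k::nat) a b x.
        \<lbrakk>\<And>i j. i \<in> {1..k} \<Longrightarrow> a i $ j < b i $ j;
         disjoint_family_on (\<lambda>i. rectangle (a i) (b i)) {1..k};
         \<And>i. i \<in> {1..k} \<Longrightarrow> x i \<in> W;
         \<And>i. i \<in> {1..k} \<Longrightarrow> rectangle (a i) (b i) \<subseteq> g (x i)\<rbrakk>
        \<Longrightarrow> (\<Sum>i\<in>{1..k}. rectangle_vol (a i) (b i)) \<le> e"
  shows "\<exists>X. W \<inter> cbox u v \<subseteq> X \<and> X \<in> lmeasurable \<and> measure lebesgue X \<le> e"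
\<comment> \<open>\<open>covering_lemma\<close> requires a nonempty open box. A degenerate
  \<open>cbox u v\<close> is itself null, and \<open>bound\<close> for the empty family gives
  \<open>0 \<le> e\<close>.\<close>
proof (cases "box u v = {}")
  case True
  have e: "0 \<le> e"
    using bound[of 0] by (simp add: disjoint_family_on_def)
  have "negligible (cbox u v)"
    using True by (simp add: negligible_interval)
  with e show ?thesis
    by (metis inf_le2 lmeasurable_cbox negligible_imp_measure0)
next
  case False
  \<comment> \<open>\<open>covering_lemma\<close> expects a gauge on the whole space. The value
    \<open>UNIV\<close> is a mere default: the boxes it supplies are controlled by \<open>g'\<close>
    at points of \<open>W\<close>, where \<open>g'\<close> agrees with \<open>g\<close>.\<close>
  define g' where "g' x = (if x \<in> W then g x else UNIV)" for x
  have "gauge g'"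
    using g by (simp add: gauge_def g'_def)
  then obtain D where D: "countable D"
      "\<And>K. K \<in> D \<Longrightarrow> interior K \<noteq> {} \<and> (\<exists>c d. K = cbox c d)"
      "pairwise (\<lambda>A B. interior A \<inter> interior B = {}) D"
      "\<And>K. K \<in> D \<Longrightarrow> \<exists>x \<in> W \<inter> cbox u v \<inter> K. K \<subseteq> g' x"
      "W \<inter> cbox u v \<subseteq> \<Union>D"
    using covering_lemma[of "W \<inter> cbox u v" u v g'] False by (metis inf_le2)
  from D(2) obtain l r where lr: "\<And>K. K \<in> D \<Longrightarrow> K = cbox (l K) (r K)"
    by metis
  from D(4) obtain p where p: "\<And>K. K \<in> D \<Longrightarrow> p K \<in> W \<and> K \<subseteq> g (p K)"
    by (metis IntE g'_def)
  have interior: "interior K = box (l K) (r K)" if "K \<in> D" for K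
    using lr[OF that] by (metis interior_cbox)
  have less: "l K $ j < r K $ j" if "K \<in> D" for K j
    using D(2)[OF that] interior[OF that] by (metis interval_ne_empty_cart(2))
  have lmeas: "K \<in> lmeasurable" if "K \<in> D" for K
    by (metis lr that lmeasurable_cbox)
  \<comment> \<open>\<open>bound\<close> concerns finite families only, but an estimate uniform over
    all finite \<open>E\<close> passes to the measure of the countable union of \<open>D\<close>.
    Overlaps of the closed boxes along faces are harmless, since subadditivity suffices.\<close>
  have fin: "measure lebesgue (\<Union>E) \<le> e" if E: "E \<subseteq> D" "finite E" for E
  proof -
    obtain h where h: "bij_betw h {1..card E} E"
      using ex_bij_betw_nat_finite_1[OF E(2)] by blast
    have hD: "h i \<in> D" if "i \<in> {1..card E}" for i
      using h E that by (auto simp: bij_betw_def)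
    have "measure lebesgue (\<Union>E) \<le> (\<Sum>K\<in>E. measure lebesgue K)"
      using E lmeas by (intro measure_Union_le) auto
    also have "\<dots> = (\<Sum>K\<in>E. rectangle_vol (l K) (r K))"
      using E less lr by (intro sum.cong refl) (metis rectangle_vol_eq_measure_cbox subsetD)
    also have "\<dots> = (\<Sum>i\<in>{1..card E}. rectangle_vol (l (h i)) (r (h i)))"
      by (rule sum.reindex_bij_betw[OF h, symmetric])
    also have "\<dots> \<le> e"
    proof (rule bound[where a = "\<lambda>i. l (h i)" and b = "\<lambda>i. r (h i)" and x = "\<lambda>i. p (h i)"])
      show "disjoint_family_on (\<lambda>i. rectangle (l (h i)) (r (h i))) {1..card E}"
        unfolding disjoint_family_on_def
      proof (intro ballI impI)
        fix i j assume ij: "i \<in> {1..card E}" "j \<in> {1..card E}" "i \<noteq> j"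
        then have "h i \<noteq> h j"
          using bij_betw_imp_inj_on[OF h] by (metis inj_onD)
        then have "interior (h i) \<inter> interior (h j) = {}"
          by (rule pairwiseD[OF D(3) hD[OF ij(1)] hD[OF ij(2)]])
        then show "rectangle (l (h i)) (r (h i)) \<inter> rectangle (l (h j)) (r (h j)) = {}"
          unfolding interior[OF hD[OF ij(1)]] interior[OF hD[OF ij(2)]] by (rule disjoint_rectangle)
      qed
      show "rectangle (l (h i)) (r (h i)) \<subseteq> g (p (h i))" if "i \<in> {1..card E}" for i
        using rectangle_subset_cbox[of "l (h i)" "r (h i)"] lr[OF hD[OF that]] p[OF hD[OF that]] by blast
    qed (use less p hD in blast)+
    finally show ?thesis .
  qed
  have "\<Union>D \<in> lmeasurable"
    using fmeasurable_Union_bound[OF D(1) lmeas fin] .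
  moreover have "measure lebesgue (\<Union>D) \<le> e"
    using measure_Union_bound[OF D(1) lmeas fin] .
  ultimately show ?thesis
    using D(5) by blast
qed

text \<open>\<open>A\<close> will be an intersection of open neighbourhoods of the preimage of
  \<open>S\<close>, one for each tolerance \<open>inverse (Suc n)\<close>. The preimages are not
  known to be measurable at this stage, so smallness is always stated through a measurable superset
  \<open>X\<close>.\<close>

lemma gauge_measurable_separation:
  fixes f :: "real ^ 'd \<Rightarrow> real ^ 'p"
  assumes f: "gauge_measurable f" and "\<eta> > 0"
    and sep: "\<And>y z. y \<in> S \<Longrightarrow> z \<in> T \<Longrightarrow> \<eta> \<le> norm (y - z)"
  obtains A where "A \<in> sets lebesgue" "f -` S \<subseteq> A" "negligible (A \<inter> f -` T)"
proof -
  have "\<exists>U V. open U \<and> open V \<and> f -` S \<subseteq> U \<and> f -` T \<subseteq> V \<and>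
      (\<forall>u v. \<exists>X. U \<inter> V \<inter> cbox u v \<subseteq> X \<and> X \<in> lmeasurable \<and> measure lebesgue X \<le> e)"
    if e: "e > 0" for e
  proof -
    obtain \<gamma> where "gauge \<gamma>" and \<gamma>: "\<And>(k::nat) a b c c'.
        \<lbrakk>\<forall>i\<in>{1..k}. \<forall>j. a i $ j < b i $ j;
         disjoint_family_on (\<lambda>i. rectangle (a i) (b i)) {1..k};
         \<forall>i\<in>{1..k}. norm (f (c i) - f (c' i)) \<ge> \<eta> \<and>
                     rectangle (a i) (b i) \<subseteq> \<gamma> (c i) \<inter> \<gamma> (c' i)\<rbrakk>
        \<Longrightarrow> (\<Sum>i\<in>{1..k}. rectangle_vol (a i) (b i)) \<le> e"
      using f[unfolded gauge_measurable_def, rule_format, OF e \<open>\<eta> > 0\<close>] by blast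
    define U where "U = (\<Union>x\<in>f -` S. \<gamma> x)"
    define V where "V = (\<Union>x\<in>f -` T. \<gamma> x)"
    \<comment> \<open>The tags of a rectangle need not lie in it. Each \<open>x\<close> in
      \<open>U \<inter> V\<close> is assigned one tag over \<open>S\<close> and one over
      \<open>T\<close>; a rectangle inside both of their gauge sets is then admissible for
      \<open>\<gamma>\<close>, because \<open>sep\<close> keeps the two values at least
      \<open>\<eta>\<close> apart.\<close>
    have "\<exists>c c'. f c \<in> S \<and> f c' \<in> T \<and> x \<in> \<gamma> c \<inter> \<gamma> c'" if "x \<in> U \<inter> V" for x
      using that by (auto simp: U_def V_def)
    then obtain c c' where
      c: "\<And>x. x \<in> U \<inter> V \<Longrightarrow> f (c x) \<in> S \<and> f (c' x) \<in> T \<and> x \<in> \<gamma> (c x) \<inter> \<gamma> (c' x)"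
      by metis
    have "\<exists>X. U \<inter> V \<inter> cbox u v \<subseteq> X \<and> X \<in> lmeasurable \<and> measure lebesgue X \<le> e" for u v
    proof (rule bounded_part_measure_le[where g = "\<lambda>x. \<gamma> (c x) \<inter> \<gamma> (c' x)"])
      show "open (\<gamma> (c x) \<inter> \<gamma> (c' x))" for x
        using \<open>gauge \<gamma>\<close> by (auto simp: gauge_def)
      fix k :: nat and a b x
      assume "\<And>i j. i \<in> {1..k} \<Longrightarrow> a i $ j < b i $ j"
        and "disjoint_family_on (\<lambda>i. rectangle (a i) (b i)) {1..k}"
        and "\<And>i. i \<in> {1..k} \<Longrightarrow> x i \<in> U \<inter> V"
        and "\<And>i. i \<in> {1..k} \<Longrightarrow> rectangle (a i) (b i) \<subseteq> \<gamma> (c (x i)) \<inter> \<gamma> (c' (x i))"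
      then show "(\<Sum>i\<in>{1..k}. rectangle_vol (a i) (b i)) \<le> e"
        using c sep by (intro \<gamma>[where c = "\<lambda>i. c (x i)" and c' = "\<lambda>i. c' (x i)"]) blast+
    qed (use c in blast)
    moreover have "open U" "open V" "f -` S \<subseteq> U" "f -` T \<subseteq> V"
      using \<open>gauge \<gamma>\<close> by (auto simp: gauge_def U_def V_def)
    ultimately show ?thesis by blast
  qed
  then have "\<forall>n::nat. \<exists>U V. open U \<and> open V \<and> f -` S \<subseteq> U \<and> f -` T \<subseteq> V \<and>
      (\<forall>u v. \<exists>X. U \<inter> V \<inter> cbox u v \<subseteq> X \<and> X \<in> lmeasurable \<and>
        measure lebesgue X \<le> inverse (Suc n))"
    by simp
  then obtain U V where UV: "\<And>n::nat. open (U n)" "\<And>n. f -` S \<subseteq> U n" "\<And>n. f -` T \<subseteq> V n"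
      "\<And>n u v. \<exists>X. U n \<inter> V n \<inter> cbox u v \<subseteq> X \<and> X \<in> lmeasurable \<and>
        measure lebesgue X \<le> inverse (Suc n)"
    by metis
  show thesis
  proof
    show "(\<Inter>n. U n) \<in> sets lebesgue"
      using UV(1) by (intro sets.countable_INT) auto
    show "f -` S \<subseteq> (\<Inter>n. U n)"
      using UV(2) by blast
    \<comment> \<open>The estimates for \<open>U n \<inter> V n\<close> hold on each box
      \<open>cbox u v\<close>, so negligibility is tested there. Every \<open>V n\<close> contains
      the preimage of \<open>T\<close>, hence the bounds \<open>inverse (Suc n)\<close> all apply to
      the same set.\<close>
    show "negligible ((\<Inter>n. U n) \<inter> f -` T)"
      unfolding negligible_on_intervals[of "(\<Inter>n. U n) \<inter> f -` T"]
    proof (intro allI)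
      fix u v
      show "negligible ((\<Inter>n. U n) \<inter> f -` T \<inter> cbox u v)"
        unfolding negligible_outer_le
      proof (intro allI impI)
        fix e :: real assume "e > 0"
        then obtain n where n: "inverse (Suc n) < e"
          using reals_Archimedean by blast
        obtain X where "U n \<inter> V n \<inter> cbox u v \<subseteq> X" "X \<in> lmeasurable"
            "measure lebesgue X \<le> inverse (Suc n)"
          using UV(4) by blast
        with n UV(3) show "\<exists>X. (\<Inter>n. U n) \<inter> f -` T \<inter> cbox u v \<subseteq> X \<and> X \<in> lmeasurable \<and>
            measure lebesgue X \<le> e"
          by (intro exI[of _ X]) fastforce
      qed
    qed
  qed
qed

text \<open>An open set is exhausted by the sets \<open>S n\<close> of points at distance at least
  \<open>inverse (Suc n)\<close> from its complement, and the separation lemma applies to each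
  \<open>S n\<close> against that complement.\<close>

lemma gauge_measurable_imp_borel_measurable:
  fixes f :: "real ^ 'd \<Rightarrow> real ^ 'p"
  assumes "gauge_measurable f"
  shows "f \<in> borel_measurable lebesgue"
proof (rule borel_measurableI)
  fix O' :: "(real ^ 'p) set" assume "open O'"
  define S where "S n = {y. \<forall>z\<in>-O'. inverse (Suc n) \<le> norm (y - z)}" for n
  have "\<exists>n. y \<in> S n" if y: "y \<in> O'" for y
  proof -
    obtain e where "e > 0" and e: "ball y e \<subseteq> O'"
      using \<open>open O'\<close> y by (meson open_contains_ball)
    obtain n where n: "inverse (Suc n) < e"
      using reals_Archimedean[OF \<open>e > 0\<close>] by blast
    have "inverse (Suc n) \<le> norm (y - z)" if "z \<in> -O'" for z
    proof -
      have "e \<le> dist y z"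
        using e that by (meson ComplD in_mono mem_ball not_less)
      then show ?thesis
        using n by (simp add: dist_norm)
    qed
    then show ?thesis
      by (auto simp: S_def)
  qed
  then have O_sub: "O' \<subseteq> (\<Union>n. S n)"
    by blast
  have "\<exists>A. A \<in> sets lebesgue \<and> f -` S n \<subseteq> A \<and> negligible (A \<inter> f -` (-O'))" for n
  proof -
    have "inverse (Suc n) \<le> norm (y - z)" if "y \<in> S n" "z \<in> -O'" for y z
      using that unfolding S_def by blast
    moreover have "0 < inverse (real (Suc n))"
      by simp
    ultimately show ?thesis
      using gauge_measurable_separation[OF assms] by metis
  qed
  then obtain A where A: "\<And>n. A n \<in> sets lebesgue" "\<And>n. f -` S n \<subseteq> A n"
      "\<And>n. negligible (A n \<inter> f -` (-O'))"
    by metis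
  have "negligible (\<Union>n. A n \<inter> f -` (-O'))"
    using A(3) by (intro negligible_countable_Union) auto
  then have "(\<Union>n. A n \<inter> f -` (-O')) \<in> sets lebesgue"
    by (simp add: negligible_imp_sets)
  \<comment> \<open>The points of the sets \<open>A n\<close> that \<open>f\<close> sends outside
    \<open>O'\<close> form a null set, measurable because Lebesgue measure is complete; removing
    them leaves exactly the preimage of \<open>O'\<close>.\<close>
  moreover have "f -` O' = (\<Union>n. A n) - (\<Union>n. A n \<inter> f -` (-O'))"
    using O_sub A(2) by blast
  ultimately show "f -` O' \<inter> space lebesgue \<in> sets lebesgue"
    using A(1) by auto
qed

section \<open>From Lebesgue measurable step functions to gauge measurability\<close>

text \<open>The gauge at \<open>x\<close> is an open neighbourhood of the whole level set through
  \<open>x\<close>. Two tags with different values confine a rectangle to the neighbourhoods of two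
  disjoint level sets, hence to the small excess \<open>W\<close> of the neighbourhoods over their
  level sets.\<close>

lemma step_gauge_measurable:
  fixes g :: "real ^ 'd \<Rightarrow> real ^ 'p"
  assumes fin: "finite (range g)" and meas: "\<And>v. g -` {v} \<in> sets lebesgue"
  shows "gauge_measurable g"
  unfolding gauge_measurable_def
proof (intro allI impI)
  fix e \<eta> :: real assume "e > 0" "\<eta> > 0"
  \<comment> \<open>Each of the \<open>m\<close> values is allotted the excess \<open>e / m\<close>,
    so that the total is at most \<open>e\<close>.\<close>
  define m where "m = card (range g)"
  have "m > 0"
    using fin by (auto simp: m_def card_gt_0_iff)
  then have "e / m > 0"
    using \<open>e > 0\<close> by simp
  have "\<exists>U. open U \<and> g -` {v} \<subseteq> U \<and> U - g -` {v} \<in> lmeasurable \<and>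
      measure lebesgue (U - g -` {v}) \<le> e / m" for v
  proof -
    obtain U where U: "open U" "g -` {v} \<subseteq> U" "U - g -` {v} \<in> lmeasurable"
        "emeasure lebesgue (U - g -` {v}) < ennreal (e / m)"
      using sets_lebesgue_outer_open[OF meas \<open>e / m > 0\<close>] by metis
    then have "measure lebesgue (U - g -` {v}) \<le> e / m"
      using \<open>e / m > 0\<close> by (simp add: emeasure_eq_measure2 ennreal_less_iff)
    with U show ?thesis by blast
  qed
  then obtain U where U: "\<And>v. open (U v)" "\<And>v. g -` {v} \<subseteq> U v"
      "\<And>v. U v - g -` {v} \<in> lmeasurable" "\<And>v. measure lebesgue (U v - g -` {v}) \<le> e / m"
    by metis
  define W where "W = (\<Union>v\<in>range g. U v - g -` {v})"
  have W: "W \<in> lmeasurable"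
    unfolding W_def using fin U(3) by (intro fmeasurable.finite_UN) auto
  have "measure lebesgue W \<le> (\<Sum>v\<in>range g. measure lebesgue (U v - g -` {v}))"
    unfolding W_def using fin U(3) by (intro measure_UNION_le) auto
  also have "\<dots> \<le> (\<Sum>v\<in>range g. e / m)"
    by (intro sum_mono U(4))
  also have "\<dots> = e"
    using \<open>m > 0\<close> by (simp add: m_def)
  finally have W_le: "measure lebesgue W \<le> e" .
  show "\<exists>\<gamma>. gauge \<gamma> \<and>
      (\<forall>(k::nat) a b c c'.
        (\<forall>i\<in>{1..k}. \<forall>j. a i $ j < b i $ j) \<longrightarrow>
        disjoint_family_on (\<lambda>i. rectangle (a i) (b i)) {1..k} \<longrightarrow>
        (\<forall>i\<in>{1..k}. norm (g (c i) - g (c' i)) \<ge> \<eta> \<and>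
                     rectangle (a i) (b i) \<subseteq> \<gamma> (c i) \<inter> \<gamma> (c' i)) \<longrightarrow>
        (\<Sum>i\<in>{1..k}. rectangle_vol (a i) (b i)) \<le> e)"
  proof (intro exI[of _ "\<lambda>x. U (g x)"] conjI allI impI)
    show "gauge (\<lambda>x. U (g x))"
      using U(1,2) by (auto simp: gauge_def)
  next
    fix k :: nat and a b c c' :: "nat \<Rightarrow> real ^ 'd"
    assume less: "\<forall>i\<in>{1..k}. \<forall>j. a i $ j < b i $ j"
      and disj: "disjoint_family_on (\<lambda>i. rectangle (a i) (b i)) {1..k}"
      and c: "\<forall>i\<in>{1..k}. norm (g (c i) - g (c' i)) \<ge> \<eta> \<and>
                rectangle (a i) (b i) \<subseteq> U (g (c i)) \<inter> U (g (c' i))"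
    have sub: "rectangle (a i) (b i) \<subseteq> W" if "i \<in> {1..k}" for i
    proof
      fix x assume "x \<in> rectangle (a i) (b i)"
      then have "x \<in> U (g (c i))" "x \<in> U (g (c' i))"
        using c that by auto
      moreover have "g (c i) \<noteq> g (c' i)"
        using c that \<open>\<eta> > 0\<close> by force
      \<comment> \<open>As \<open>g x\<close> cannot equal both tag values, \<open>x\<close> is in
        the excess of the second neighbourhood if \<open>g x = g (c i)\<close>, and of the first
        otherwise.\<close>
      ultimately show "x \<in> W"
        unfolding W_def by (cases "g x = g (c i)") auto
    qed
    have "(\<Sum>i\<in>{1..k}. rectangle_vol (a i) (b i))
        \<le> (\<Sum>i\<in>{1..k}. measure lebesgue (rectangle (a i) (b i)))"
      using less by (intro sum_mono rectangle_vol_le_measure) auto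
    also have "\<dots> = measure lebesgue (\<Union>i\<in>{1..k}. rectangle (a i) (b i))"
      using disj lmeasurable_rectangle
      by (intro measure_finite_Union[symmetric]) (auto simp: fmeasurable_def less_top)
    also have "\<dots> \<le> measure lebesgue W"
      using W
    proof (rule measure_mono_fmeasurable[rotated 2])
      show "(\<Union>i\<in>{1..k}. rectangle (a i) (b i)) \<subseteq> W"
        using sub by blast
      show "(\<Union>i\<in>{1..k}. rectangle (a i) (b i)) \<in> sets lebesgue"
        by (intro sets.finite_UN fmeasurableD lmeasurable_rectangle) simp
    qed
    finally show "(\<Sum>i\<in>{1..k}. rectangle_vol (a i) (b i)) \<le> e"
      using W_le by linarith
  qed
qed

section \<open>Dominated approximation by simple functions\<close>

lemma nonneg_simple_approximation:
  fixes u :: "'a \<Rightarrow> real"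
  assumes "u \<in> borel_measurable M" "\<And>x. 0 \<le> u x"
  obtains s where "\<And>n::nat. simple_function M (s n)" "\<And>x. (\<lambda>n. s n x) \<longlonglongrightarrow> u x"
    "\<And>n x. 0 \<le> s n x" "\<And>n x. s n x \<le> u x"
proof -
  obtain s where s: "incseq s" "\<And>n::nat. simple_function M (s n)"
      "\<And>x. bdd_above (range (\<lambda>n. s n x))" "\<And>n x. 0 \<le> s n x" and u: "u = (SUP n. s n)"
    using borel_measurable_implies_simple_function_sequence_real[OF assms] by metis
  have u_eq: "u x = (SUP n. s n x)" for x
    by (simp add: u image_comp)
  have "(\<lambda>n. s n x) \<longlonglongrightarrow> u x" for x
    unfolding u_eq using s(1,3) by (intro LIMSEQ_incseq_SUP) (auto simp: incseq_def le_fun_def)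
  moreover have "s n x \<le> u x" for n x
    unfolding u_eq by (intro cSUP_upper s(3)) simp
  ultimately show thesis
    using that s(2,4) by blast
qed

lemma real_simple_approximation:
  fixes h :: "'a \<Rightarrow> real"
  assumes [measurable]: "h \<in> borel_measurable M"
  obtains s where "\<And>n::nat. simple_function M (s n)" "\<And>x. (\<lambda>n. s n x) \<longlonglongrightarrow> h x"
    "\<And>n x. \<bar>s n x\<bar> \<le> \<bar>h x\<bar>"
proof -
  have meas: "(\<lambda>x. max (h x) 0) \<in> borel_measurable M" "(\<lambda>x. max (- h x) 0) \<in> borel_measurable M"
    by measurable
  obtain p where p: "\<And>n::nat. simple_function M (p n)" "\<And>x. (\<lambda>n. p n x) \<longlonglongrightarrow> max (h x) 0"
      "\<And>n x. 0 \<le> p n x" "\<And>n x. p n x \<le> max (h x) 0"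
    using nonneg_simple_approximation[OF meas(1)] by auto
  obtain q where q: "\<And>n::nat. simple_function M (q n)" "\<And>x. (\<lambda>n. q n x) \<longlonglongrightarrow> max (- h x) 0"
      "\<And>n x. 0 \<le> q n x" "\<And>n x. q n x \<le> max (- h x) 0"
    using nonneg_simple_approximation[OF meas(2)] by auto
  show thesis
  proof
    show "simple_function M (\<lambda>x. p n x - q n x)" for n
      using p(1) q(1) by (rule simple_function_diff)
    have "h x = max (h x) 0 - max (- h x) 0" for x
      by linarith
    then show "(\<lambda>n. p n x - q n x) \<longlonglongrightarrow> h x" for x
      using tendsto_diff[OF p(2)[of x] q(2)[of x]] by metis
    \<comment> \<open>At every point the positive or the negative part of \<open>h\<close> vanishes,
      and with it \<open>p n\<close> or \<open>q n\<close>; the other is at most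
      \<open>\<bar>h x\<bar>\<close>.\<close>
    show "\<bar>p n x - q n x\<bar> \<le> \<bar>h x\<bar>" for n x
      using p(3,4)[of n x] q(3,4)[of n x] by linarith
  qed
qed

theorem proposition8p1:
  fixes f :: "real ^ 'd \<Rightarrow> real ^ 'p"
  assumes "gauge_measurable f"
  shows "\<exists>F :: nat \<Rightarrow> real ^ 'd \<Rightarrow> real ^ 'p.
           (\<forall>n. gauge_measurable (F n) \<and> step_function (F n)) \<and>
           (\<forall>x. (\<lambda>n. F n x) \<longlonglongrightarrow> f x) \<and>
           (\<forall>n x. norm (F n x) \<le> norm (f x))"
proof -
  have "f \<in> borel_measurable lebesgue"
    by (rule gauge_measurable_imp_borel_measurable[OF assms])
  then have comp: "(\<lambda>x. f x $ j) \<in> borel_measurable lebesgue" for j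
    by (rule measurable_compose[OF _ borel_measurable_continuous_onI])
      (intro continuous_intros)
  have "\<exists>s. (\<forall>n::nat. simple_function lebesgue (s n)) \<and> (\<forall>x. (\<lambda>n. s n x) \<longlonglongrightarrow> f x $ j) \<and>
      (\<forall>n x. \<bar>s n x\<bar> \<le> \<bar>f x $ j\<bar>)" for j
    using real_simple_approximation[OF comp[of j]] by metis
  then obtain s where s: "\<And>j n. simple_function lebesgue (s j n)"
      "\<And>j x. (\<lambda>n::nat. s j n x) \<longlonglongrightarrow> f x $ j" "\<And>j n x. \<bar>s j n x\<bar> \<le> \<bar>f x $ j\<bar>"
    by metis
  \<comment> \<open>Working coordinatewise is enough: domination in every coordinate gives
    domination in norm, and both the range and the level sets of \<open>F n\<close> are controlled
    by those of its finitely many coordinates.\<close>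
  define F where "F n x = (\<chi> j. s j n x)" for n x
  have fin: "finite (range (F n))" for n
  proof (rule finite_subset)
    show "range (F n) \<subseteq> vec_lambda ` (\<Pi>\<^sub>E j\<in>UNIV. range (s j n))"
      by (auto simp: F_def)
    show "finite (vec_lambda ` (\<Pi>\<^sub>E j\<in>UNIV. range (s j n)))"
      using simple_functionD(1)[OF s(1)] by (intro finite_imageI[where h = vec_lambda] finite_PiE) auto
  qed
  have "F n -` {v} \<in> sets lebesgue" for n v
  proof -
    have "F n -` {v} = (\<Inter>j. s j n -` {v $ j} \<inter> space lebesgue)"
      by (auto simp: F_def vec_eq_iff)
    also have "\<dots> \<in> sets lebesgue"
      using simple_functionD(2)[OF s(1)] by (intro sets.countable_INT'') auto
    finally show ?thesis .
  qed
  with fin have "gauge_measurable (F n) \<and> step_function (F n)" for n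
    by (simp add: step_gauge_measurable step_function_def)
  moreover have "(\<lambda>n. F n x) \<longlonglongrightarrow> f x" for x
    unfolding F_def by (rule vec_tendstoI) (simp add: s(2))
  moreover have "norm (F n x) \<le> norm (f x)" for n x
    by (rule norm_le_componentwise_cart) (simp add: F_def s(3))
  ultimately show ?thesis by blast
qed

end
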